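(* Let $A,A',B,B'$ be finite simple graphs. If $A,A'$ are homotopic and $B,B'$ are homotopic, then the strong product $A\cdot B$ is homotopic to the strong product $A'\cdot B'$.
   Context: The strong product of graphs $(V,E)$ and $(W,F)$ is the graph with vertex set $V\times W$ in which two distinct vertices $(a,b)$, $(c,d)$ are adjacent iff ($a=c$ or $(a,c)\in E$) and ($b=d$ or $(b,d)\in F$). For a vertex $x$ of a finite simple graph, the unit sphere $S(x)$ is the subgraph induced by the neighbors of $x$. Contractible graphs are defined recursively: the one-point graph $K_1$ is contractible; a graph $B$ is contractible if there is a vertex $v$ such that both $S(v)$ and $B-v$ (the graph induced by the vertices other than $v$) are contractible. A homotopy step is either removing a vertex $v$ (with its edges) for which $S(v)$ is contractible, or the reverse: choosing a contractible (induced) subgraph $C$ of a graph and adding a new vertex $v$ connected exactly to all vertices of $C$. Two finite simple graphs are homotopic if one is obtained from the other, up to isomorphism, by finitely many homotopy steps. *)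

theory Defs
  imports "Graph_Theory.Graph_Theory"
begin

text \<open>
  Finite simple graphs are the locale \<open>pair_graph\<close>: a finite vertex set (possibly empty) and a
  finite, symmetric, irreflexive set of arcs between vertices, so that an undirected edge is the
  pair of its two arcs.
\<close>

definition pair_induce :: "'a pair_pre_digraph \<Rightarrow> 'a set \<Rightarrow> 'a pair_pre_digraph" where
  "pair_induce G S = \<lparr> pverts = S, parcs = {(u, w) \<in> parcs G. u \<in> S \<and> w \<in> S} \<rparr>"

lemma with_proj_pair_induce: "with_proj (pair_induce G S) = with_proj G \<restriction> S"
  by (auto simp: pair_induce_def with_proj_def induce_subgraph_def)

definition unit_sphere :: "'a pair_pre_digraph \<Rightarrow> 'a \<Rightarrow> 'a pair_pre_digraph" where
  "unit_sphere G x = pair_induce G {y. (x, y) \<in> parcs G}"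

definition remove_vertex :: "'a pair_pre_digraph \<Rightarrow> 'a \<Rightarrow> 'a pair_pre_digraph" where
  "remove_vertex G v = pair_induce G (pverts G - {v})"

definition add_vertex ::
    "'a pair_pre_digraph \<Rightarrow> 'a pair_pre_digraph \<Rightarrow> 'a \<Rightarrow> 'a pair_pre_digraph" where
  "add_vertex G C v =
     \<lparr> pverts = insert v (pverts G),
       parcs = parcs G \<union> {v} \<times> pverts C \<union> pverts C \<times> {v} \<rparr>"

inductive contractible_graph :: "'a pair_pre_digraph \<Rightarrow> bool" where
  K1: "contractible_graph \<lparr> pverts = {v}, parcs = {} \<rparr>"
| step: "contractible_graph B"
    if "pair_graph B" and "v \<in> pverts B"
      and "contractible_graph (unit_sphere B v)" and "contractible_graph (remove_vertex B v)"

inductive homotopy_step :: "'a pair_pre_digraph \<Rightarrow> 'a pair_pre_digraph \<Rightarrow> bool" where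
  remove: "homotopy_step G (remove_vertex G v)"
    if "pair_graph G" and "v \<in> pverts G" and "contractible_graph (unit_sphere G v)"
| add: "homotopy_step G (add_vertex G C v)"
    if "pair_graph G" and "v \<notin> pverts G"
      and "induced_subgraph (with_proj C) (with_proj G)" and "contractible_graph C"

text \<open>
  The steps are taken between isomorphic copies with vertices in \<open>nat\<close>: every finite graph has such
  a copy, and it always leaves room for new vertices, whereas the vertex type of the given graph
  may be finite. This also lets the two graphs have different vertex types.
\<close>

definition homotopic_graphs :: "'a pair_pre_digraph \<Rightarrow> 'b pair_pre_digraph \<Rightarrow> bool" where
  "homotopic_graphs G H \<longleftrightarrow>
     (\<exists>G' H' :: nat pair_pre_digraph.
        digraph_iso (with_proj G) (with_proj G') \<and>
        homotopy_step\<^sup>*\<^sup>* G' H' \<and>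
        digraph_iso (with_proj H') (with_proj H))"

definition strong_product ::
    "'a pair_pre_digraph \<Rightarrow> 'b pair_pre_digraph \<Rightarrow> ('a \<times> 'b) pair_pre_digraph" where
  "strong_product G H =
     \<lparr> pverts = pverts G \<times> pverts H,
       parcs = {((a, b), (c, d)).
         (a, b) \<in> pverts G \<times> pverts H \<and> (c, d) \<in> pverts G \<times> pverts H \<and> (a, b) \<noteq> (c, d) \<and>
         (a = c \<or> (a, c) \<in> parcs G) \<and> (b = d \<or> (b, d) \<in> parcs H)} \<rparr>"

end

theory Submission
  imports Defs
begin

text \<open>
  It is enough to change one factor by one homotopy step, since the strong product is commutative up
  to isomorphism; and since steps are reversible, it is enough to remove a vertex \<open>v\<close> with contractible
  sphere \<open>S\<close> from \<open>A\<close>. Then the vertices \<open>(v, t)\<close> can be removed from \<open>A \<cdot> B\<close> one by one, in any order.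
  If the vertices \<open>(v, u)\<close> with \<open>u \<in> T\<close> are the ones still present, the sphere of \<open>(v, t)\<close> is
  \<open>S \<times> ({t} \<union> N(t)) \<union> {v} \<times> (T \<inter> N(t))\<close>,
  a product of a contractible graph with a cone, enlarged by some vertices over \<open>v\<close>.

  Such an enlarged product \<open>X \<times> L \<union> {v} \<times> T\<close>, where \<open>T \<subseteq> L\<close>, is contractible as soon as \<open>X \<times> L\<close> is and
  the products of the sphere of \<open>v\<close> with contractible sets are (\<open>contractible_on_partial_product\<close>):
  the sphere of any \<open>(v, t)\<close> has the shape just described (with \<open>N(t)\<close> taken in \<open>L\<close>),
  which is again an enlarged product, but over
  \<open>T \<inter> N(t)\<close>, which does not contain \<open>t\<close>, so that induction on the size of \<open>T\<close> applies. Cones are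
  contractible (\<open>contractible_on_cone\<close>), and taking \<open>T = L\<close> in the same statement shows inductively that
  products of contractible graphs are contractible (\<open>contractible_on_Times\<close>).

  What remains is bookkeeping about isomorphic copies: homotopies can be transported along an
  isomorphism onto a graph with vertices in \<^typ>\<open>nat\<close> (\<open>homotopy_step_transport\<close>), which makes homotopy
  transitive and lets steps between graphs of any vertex type count as a homotopy.
\<close>

section \<open>Graphs induced by a relation\<close>

lemma pair_graph_iff:
  "pair_graph G \<longleftrightarrow>
     finite (pverts G) \<and> parcs G \<subseteq> pverts G \<times> pverts G \<and> sym (parcs G) \<and> irrefl (parcs G)"
proof
  assume "pair_graph G"
  then interpret pair_graph G .
  show "finite (pverts G) \<and> parcs G \<subseteq> pverts G \<times> pverts G \<and> sym (parcs G) \<and> irrefl (parcs G)"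
    using pair_finite_verts arcs_symmetric no_loops'
    by (auto simp: sym_def irrefl_def dest: in_arcsD1 in_arcsD2)
next
  assume *: "finite (pverts G) \<and> parcs G \<subseteq> pverts G \<times> pverts G \<and> sym (parcs G) \<and> irrefl (parcs G)"
  then have "finite (parcs G)"
    by (meson finite_SigmaI finite_subset)
  with * show "pair_graph G"
    by unfold_locales (auto simp: symmetric_def irrefl_def)
qed

text \<open>
  Fixing one adjacency relation and varying only the vertex set makes all graphs occurring in a
  deformation comparable: spheres and vertex removals become intersections and differences of sets.
\<close>

definition graph_on :: "'a rel \<Rightarrow> 'a set \<Rightarrow> 'a pair_pre_digraph" where
  "graph_on E S = \<lparr> pverts = S, parcs = E \<inter> S \<times> S \<rparr>"

lemma graph_on_simps [simp]: "pverts (graph_on E S) = S" "parcs (graph_on E S) = E \<inter> S \<times> S"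
  by (auto simp: graph_on_def)

lemma graph_on_parcs: "pair_graph G \<Longrightarrow> graph_on (parcs G) (pverts G) = G"
  by (auto simp: pair_graph_iff graph_on_def intro!: pair_pre_digraph.equality)

lemma pair_graph_graph_on: "finite S \<Longrightarrow> sym E \<Longrightarrow> irrefl E \<Longrightarrow> pair_graph (graph_on E S)"
  by (auto simp: pair_graph_iff sym_def irrefl_def)

lemma unit_sphere_graph_on: "v \<in> S \<Longrightarrow> unit_sphere (graph_on E S) v = graph_on E (S \<inter> E `` {v})"
  by (auto simp: unit_sphere_def pair_induce_def graph_on_def)

lemma remove_vertex_graph_on: "remove_vertex (graph_on E S) v = graph_on E (S - {v})"
  by (auto simp: remove_vertex_def pair_induce_def graph_on_def)

lemma pair_graph_remove_vertex: "pair_graph G \<Longrightarrow> pair_graph (remove_vertex G v)"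
  by (auto simp: pair_graph_iff remove_vertex_def pair_induce_def sym_def irrefl_def)

section \<open>Contractible vertex sets\<close>

text \<open>
  Contractibility of \<^term>\<open>graph_on E S\<close> with the relation kept fixed as a parameter, so that inductions
  range over sets only.
\<close>

inductive contractible_on :: "'a rel \<Rightarrow> 'a set \<Rightarrow> bool" for E where
  point: "contractible_on E {v}"
| cut: "contractible_on E S"
    if "v \<in> S" and "contractible_on E (S \<inter> E `` {v})" and "contractible_on E (S - {v})"

lemma contractible_on_finite: "contractible_on E S \<Longrightarrow> finite S"
  by (induction rule: contractible_on.induct) auto

lemma contractible_on_image:
  assumes "contractible_on E S" and "inj_on f S"
    and "\<And>x y. x \<in> S \<Longrightarrow> y \<in> S \<Longrightarrow> (f x, f y) \<in> E' \<longleftrightarrow> (x, y) \<in> E"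
  shows "contractible_on E' (f ` S)"
  using assms
proof (induction rule: contractible_on.induct)
  case (point v)
  then show ?case by (auto intro: contractible_on.point)
next
  case (cut v S)
  have "contractible_on E' (f ` (S \<inter> E `` {v}))"
    using cut.prems by (intro cut.IH) (auto simp: inj_on_def)
  moreover have "f ` (S \<inter> E `` {v}) = f ` S \<inter> E' `` {f v}"
    using cut.prems cut.hyps(1) by auto
  moreover have "contractible_on E' (f ` (S - {v}))"
    using cut.prems by (intro cut.IH) (auto simp: inj_on_def)
  moreover have "f ` (S - {v}) = f ` S - {f v}"
    using cut.prems cut.hyps(1) by (auto simp: inj_on_def)
  ultimately show ?case
    using cut.hyps(1) by (auto intro: contractible_on.cut[of "f v"])
qed

lemma contractible_on_cong:
  assumes "contractible_on E S" and "\<And>x y. x \<in> S \<Longrightarrow> y \<in> S \<Longrightarrow> (x, y) \<in> E' \<longleftrightarrow> (x, y) \<in> E"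
  shows "contractible_on E' S"
  using contractible_on_image[of E S "\<lambda>x. x" E'] assms by auto

lemma contractible_graph_on:
  assumes "contractible_on E S" and "sym E" and "irrefl E"
  shows "contractible_graph (graph_on E S)"
  using assms(1)
proof (induction rule: contractible_on.induct)
  case (point v)
  have "graph_on E {v} = \<lparr> pverts = {v}, parcs = {} \<rparr>"
    using assms(3) by (auto simp: graph_on_def irrefl_def)
  then show ?case by (simp add: contractible_graph.K1)
next
  case (cut v S)
  have "finite S"
    using contractible_on_finite[OF cut.hyps(3)] by simp
  then show ?case
    using cut assms contractible_graph.step[of "graph_on E S" v]
    by (simp add: unit_sphere_graph_on remove_vertex_graph_on pair_graph_graph_on)
qed

lemma contractible_graphD:
  "contractible_graph G \<Longrightarrow> pair_graph G \<and> contractible_on (parcs G) (pverts G)"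
proof (induction rule: contractible_graph.induct)
  case (K1 v)
  then show ?case
    by (auto simp: pair_graph_iff sym_def irrefl_def intro: contractible_on.point)
next
  case (step B v)
  have B: "graph_on (parcs B) (pverts B) = B"
    using step.hyps(1) by (rule graph_on_parcs)
  have "unit_sphere B v = graph_on (parcs B) (pverts B \<inter> parcs B `` {v})"
    using unit_sphere_graph_on[OF step.hyps(2), of "parcs B"] B by simp
  moreover have "remove_vertex B v = graph_on (parcs B) (pverts B - {v})"
    using remove_vertex_graph_on[of "parcs B" "pverts B" v] B by simp
  ultimately have "contractible_on (parcs B) (pverts B \<inter> parcs B `` {v})"
    and "contractible_on (parcs B) (pverts B - {v})"
    using step.IH by (auto intro: contractible_on_cong)
  then show ?case
    using step.hyps(1,2) by (blast intro: contractible_on.cut)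
qed

text \<open>
  The apex \<^term>\<open>t\<close> survives everything: removing another vertex \<open>s\<close> leaves a smaller cone, and the sphere of
  \<open>s\<close> contains \<^term>\<open>t\<close>, hence is a smaller cone as well.
\<close>

lemma contractible_on_cone:
  assumes "finite M" and "M \<subseteq> F `` {t}" and "sym F" and "irrefl F"
  shows "contractible_on F (insert t M)"
  using assms(1,2)
proof (induction M rule: finite_psubset_induct)
  case (psubset M)
  show ?case
  proof (cases "M = {}")
    case True
    then show ?thesis by (simp add: contractible_on.point)
  next
    case False
    then obtain s where s: "s \<in> M" by blast
    then have "(t, s) \<in> F" "(s, t) \<in> F" "s \<noteq> t" "(s, s) \<notin> F"
      using psubset.prems assms(3,4) by (auto simp: sym_def irrefl_def)
    then have "insert t M \<inter> F `` {s} = insert t (M \<inter> F `` {s})"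
      and "insert t M - {s} = insert t (M - {s})" and "M \<inter> F `` {s} \<subset> M"
      using s by auto
    moreover have "contractible_on F (insert t (M \<inter> F `` {s}))"
      using psubset.prems \<open>M \<inter> F `` {s} \<subset> M\<close> by (intro psubset.IH) auto
    moreover have "contractible_on F (insert t (M - {s}))"
      using psubset.prems s by (intro psubset.IH) auto
    ultimately show ?thesis
      using s contractible_on.cut[of s "insert t M" F] by simp
  qed
qed

section \<open>Strong products of contractible sets\<close>

text \<open>
  The adjacency of the strong product before restriction to the vertices; every induced subgraph of a
  strong product is then a \<^const>\<open>graph_on\<close> of this one relation.
\<close>

definition strong_rel :: "'a rel \<Rightarrow> 'b rel \<Rightarrow> ('a \<times> 'b) rel" where
  "strong_rel E F = {((a, b), (c, d)).
     (a, b) \<noteq> (c, d) \<and> (a = c \<or> (a, c) \<in> E) \<and> (b = d \<or> (b, d) \<in> F)}"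

lemma sym_strong_rel: "sym E \<Longrightarrow> sym F \<Longrightarrow> sym (strong_rel E F)"
  unfolding sym_def strong_rel_def by blast

lemma irrefl_strong_rel: "irrefl (strong_rel E F)"
  by (auto simp: irrefl_def strong_rel_def)

lemma strong_product_eq:
  "strong_product G H = graph_on (strong_rel (parcs G) (parcs H)) (pverts G \<times> pverts H)"
  by (auto simp: strong_product_def graph_on_def strong_rel_def)

lemma pair_graph_strong_product:
  "pair_graph G \<Longrightarrow> pair_graph H \<Longrightarrow> pair_graph (strong_product G H)"
  by (auto simp: strong_product_eq pair_graph_iff[of G] pair_graph_iff[of H]
      intro!: pair_graph_graph_on sym_strong_rel irrefl_strong_rel)

text \<open>
  A neighbour of \<open>(v, t)\<close> lies over a neighbour of \<^term>\<open>v\<close> and then anywhere in the closed neighbourhood of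
  \<^term>\<open>t\<close>, or over \<^term>\<open>v\<close> itself and then in the open one. The closed neighbourhood is a cone with apex
  \<^term>\<open>t\<close>, whatever the shape of \<^term>\<open>L\<close>.
\<close>

lemma sphere_in_partial_product:
  assumes "irrefl F" and "irrefl E" and "v \<notin> X" and "T \<subseteq> L" and "t \<in> T"
  shows "(X \<times> L \<union> {v} \<times> T) \<inter> strong_rel E F `` {(v, t)} =
    (X \<inter> E `` {v}) \<times> insert t (L \<inter> F `` {t}) \<union> {v} \<times> (T \<inter> F `` {t})"
  using assms by (auto simp: strong_rel_def irrefl_def)

text \<open>
  The heart of the argument. Cut at any \<open>(v, t)\<close> with \<open>t \<in> T\<close>. What is left is the same situation for
  \<open>T - {t}\<close>; the sphere is the same situation for \<open>T \<inter> N(t)\<close>, with the sphere of \<^term>\<open>v\<close> in place of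
  \<^term>\<open>X\<close> and the cone over \<open>t\<close> in place of \<^term>\<open>L\<close>. For this second use the induction has to
  generalise over \<^term>\<open>X\<close> and \<^term>\<open>L\<close>, and the hypothesis on products has to speak of all contractible
  sets rather than of \<^term>\<open>L\<close> alone.
\<close>

lemma contractible_on_partial_product:
  assumes "sym F" and "irrefl F" and "irrefl E" and "v \<notin> X"
    and "finite T" and "finite L" and "T \<subseteq> L"
    and sphere: "\<And>M. contractible_on F M \<Longrightarrow> contractible_on (strong_rel E F) ((X \<inter> E `` {v}) \<times> M)"
    and "contractible_on (strong_rel E F) (X \<times> L)"
  shows "contractible_on (strong_rel E F) (X \<times> L \<union> {v} \<times> T)"
  using assms(4-)
proof (induction "card T" arbitrary: X L T rule: less_induct)
  case less
  show ?case
  proof (cases "T = {}")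
    case True
    then show ?thesis using less.prems by simp
  next
    case False
    then obtain t where t: "t \<in> T" by blast
    define M where "M = insert t (L \<inter> F `` {t})"
    have M: "contractible_on F M"
      unfolding M_def using assms(1,2) less.prems(3) by (intro contractible_on_cone) auto
    have "T \<inter> F `` {t} \<subset> T" "T - {t} \<subset> T"
      using t assms(2) by (auto simp: irrefl_def)
    then have card: "card (T \<inter> F `` {t}) < card T" "card (T - {t}) < card T"
      using less.prems(2) by (auto intro: psubset_card_mono)
    have "contractible_on (strong_rel E F) ((X \<inter> E `` {v}) \<times> M \<union> {v} \<times> (T \<inter> F `` {t}))"
      using less.prems M by (intro less.hyps[OF card(1)]) (auto simp: M_def)
    then have "contractible_on (strong_rel E F)
        ((X \<times> L \<union> {v} \<times> T) \<inter> strong_rel E F `` {(v, t)})"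
      using assms(2,3) less.prems t by (simp add: sphere_in_partial_product M_def)
    moreover have "contractible_on (strong_rel E F) (X \<times> L \<union> {v} \<times> (T - {t}))"
      using less.prems by (intro less.hyps[OF card(2)]) auto
    moreover have "X \<times> L \<union> {v} \<times> (T - {t}) = (X \<times> L \<union> {v} \<times> T) - {(v, t)}"
      using less.prems(1) by auto
    moreover have "(v, t) \<in> X \<times> L \<union> {v} \<times> T"
      using t by simp
    ultimately show ?thesis
      by (metis contractible_on.cut)
  qed
qed

text \<open>
  Follows the construction of \<^term>\<open>K\<close>: adding a vertex \<open>v\<close> to the first factor enlarges the product by
  the full layer \<open>{v} \<times> L\<close>, and the induction hypothesis for the sphere of \<open>v\<close> is just what
  \<open>contractible_on_partial_product\<close> asks for.
\<close>

lemma contractible_on_Times: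
  assumes "contractible_on E K" and "contractible_on F L"
    and "irrefl E" and "sym F" and "irrefl F"
  shows "contractible_on (strong_rel E F) (K \<times> L)"
  using assms(1,2)
proof (induction arbitrary: L rule: contractible_on.induct)
  case (point v)
  have "contractible_on (strong_rel E F) (Pair v ` L)"
    using assms(5) by (intro contractible_on_image[OF point])
      (auto simp: strong_rel_def irrefl_def inj_on_def)
  moreover have "Pair v ` L = {v} \<times> L" by auto
  ultimately show ?case by simp
next
  case (cut v S)
  have S: "(S - {v}) \<inter> E `` {v} = S \<inter> E `` {v}"
    using assms(3) by (auto simp: irrefl_def)
  have "contractible_on (strong_rel E F) ((S - {v}) \<times> L \<union> {v} \<times> L)"
    using assms(3-5) cut contractible_on_finite[OF cut.prems]
    by (intro contractible_on_partial_product) (auto simp: S)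
  moreover have "(S - {v}) \<times> L \<union> {v} \<times> L = S \<times> L"
    using cut.hyps(1) by auto
  ultimately show ?case by simp
qed

section \<open>Homotopy steps\<close>

text \<open>
  The two kinds of steps undo each other literally, not merely up to isomorphism. Hence steps form a
  symmetric relation, and every statement about a step reduces to the removal of a vertex.
\<close>

lemma add_vertex_eqs:
  assumes "pair_graph G" and "v \<notin> pverts G" and "induced_subgraph (with_proj C) (with_proj G)"
  shows "remove_vertex (add_vertex G C v) v = G" and "unit_sphere (add_vertex G C v) v = C"
    and "pair_graph (add_vertex G C v)"
proof -
  have C: "pverts C \<subseteq> pverts G" "parcs C = parcs G \<inter> pverts C \<times> pverts C"
    using assms(3) by (auto simp: induced_subgraph_def subgraph_def)
  have G: "finite (pverts G)" "parcs G \<subseteq> pverts G \<times> pverts G" "sym (parcs G)" "irrefl (parcs G)"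
    using assms(1) by (auto simp: pair_graph_iff)
  show "remove_vertex (add_vertex G C v) v = G"
    using C G assms(2)
    by (auto simp: remove_vertex_def add_vertex_def pair_induce_def intro!: pair_pre_digraph.equality)
  have nbrs: "{y. (v, y) \<in> parcs (add_vertex G C v)} = pverts C"
    using C G assms(2) by (auto simp: add_vertex_def)
  show "unit_sphere (add_vertex G C v) v = C"
    unfolding unit_sphere_def nbrs using C G assms(2)
    by (auto simp: add_vertex_def pair_induce_def intro!: pair_pre_digraph.equality)
  show "pair_graph (add_vertex G C v)"
    using C G assms(2) by (auto simp: pair_graph_iff add_vertex_def sym_def irrefl_def)
qed

lemma add_vertex_unit_sphere:
  assumes "pair_graph G" and "v \<in> pverts G"
  shows "add_vertex (remove_vertex G v) (unit_sphere G v) v = G"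
    and "induced_subgraph (with_proj (unit_sphere G v)) (with_proj (remove_vertex G v))"
proof -
  have G: "finite (pverts G)" "parcs G \<subseteq> pverts G \<times> pverts G" "sym (parcs G)" "irrefl (parcs G)"
    using assms(1) by (auto simp: pair_graph_iff)
  show "add_vertex (remove_vertex G v) (unit_sphere G v) v = G"
    using G assms(2)
    by (auto simp: remove_vertex_def unit_sphere_def add_vertex_def pair_induce_def sym_def
        irrefl_def intro!: pair_pre_digraph.equality)
  show "induced_subgraph (with_proj (unit_sphere G v)) (with_proj (remove_vertex G v))"
    using G assms(2)
    by (auto simp: remove_vertex_def unit_sphere_def pair_induce_def irrefl_def
        induced_subgraph_def subgraph_def compatible_def wf_digraph_def)
qed

lemma homotopy_step_pair_graph: "homotopy_step G K \<Longrightarrow> pair_graph G \<and> pair_graph K"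
  by (auto elim!: homotopy_step.cases intro: pair_graph_remove_vertex add_vertex_eqs(3))

lemma homotopy_steps_pair_graph: "homotopy_step\<^sup>*\<^sup>* G K \<Longrightarrow> pair_graph G \<Longrightarrow> pair_graph K"
  by (induction rule: rtranclp_induct) (auto dest: homotopy_step_pair_graph)

lemma homotopy_step_sym: "homotopy_step G K \<Longrightarrow> homotopy_step K G"
proof (induction rule: homotopy_step.induct)
  case (remove G v)
  have "homotopy_step (remove_vertex G v) (add_vertex (remove_vertex G v) (unit_sphere G v) v)"
    using remove
    by (intro homotopy_step.add pair_graph_remove_vertex add_vertex_unit_sphere(2))
      (auto simp: remove_vertex_def pair_induce_def)
  then show ?case
    using remove by (simp add: add_vertex_unit_sphere(1))
next
  case (add G v C)
  note eqs = add_vertex_eqs[OF add(1-3)]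
  have "homotopy_step (add_vertex G C v) (remove_vertex (add_vertex G C v) v)"
    using eqs add(4) by (intro homotopy_step.remove) (auto simp: add_vertex_def)
  then show ?case
    using eqs by simp
qed

lemma homotopy_steps_sym: "homotopy_step\<^sup>*\<^sup>* G K \<Longrightarrow> homotopy_step\<^sup>*\<^sup>* K G"
  by (metis homotopy_step_sym sympD sympI symp_rtranclp)

text \<open>
  The layer over \<^term>\<open>v\<close> is peeled off vertex by vertex; at each stage the sphere to be contracted is an
  enlarged product to which \<open>contractible_on_partial_product\<close> applies.
\<close>

lemma homotopy_steps_partial_product:
  assumes "sym E" and "irrefl E" and "sym F" and "irrefl F"
    and "finite X" and "finite L" and "v \<notin> X" and "T \<subseteq> L"
    and "contractible_on E (X \<inter> E `` {v})"
  shows "homotopy_step\<^sup>*\<^sup>* (graph_on (strong_rel E F) (X \<times> L \<union> {v} \<times> T))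
    (graph_on (strong_rel E F) (X \<times> L))"
proof -
  note rel = sym_strong_rel[OF assms(1,3)] irrefl_strong_rel[of E F]
  have "finite T" using assms(6,8) finite_subset by blast
  then show ?thesis
    using assms(8)
  proof (induction T rule: finite_induct)
    case empty
    then show ?case by simp
  next
    case (insert t T)
    let ?U = "X \<times> L \<union> {v} \<times> insert t T"
    define M where "M = insert t (L \<inter> F `` {t})"
    have M: "contractible_on F M"
      unfolding M_def using assms(3,4,6) by (intro contractible_on_cone) auto
    have prod: "contractible_on (strong_rel E F) ((X \<inter> E `` {v}) \<times> N)"
      if "contractible_on F N" for N
      using that assms by (intro contractible_on_Times) auto
    have "contractible_on (strong_rel E F)
        ((X \<inter> E `` {v}) \<times> M \<union> {v} \<times> (insert t T \<inter> F `` {t}))"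
    proof (rule contractible_on_partial_product[OF assms(3,4,2)])
      show "contractible_on (strong_rel E F) ((X \<inter> E `` {v} \<inter> E `` {v}) \<times> N)"
        if "contractible_on F N" for N
        using prod[OF that] by (simp add: Int_assoc)
      show "insert t T \<inter> F `` {t} \<subseteq> M"
        using insert.prems by (auto simp: M_def)
    qed (use assms(7) insert.hyps(1) contractible_on_finite[OF M] prod[OF M] in auto)
    then have "contractible_on (strong_rel E F) (?U \<inter> strong_rel E F `` {(v, t)})"
      unfolding M_def
        sphere_in_partial_product[OF assms(4,2,7) insert.prems insertI1] .
    then have "homotopy_step (graph_on (strong_rel E F) ?U)
        (remove_vertex (graph_on (strong_rel E F) ?U) (v, t))"
      using rel assms insert
      by (intro homotopy_step.remove)
        (auto simp: unit_sphere_graph_on intro!: pair_graph_graph_on contractible_graph_on)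
    moreover have "?U - {(v, t)} = X \<times> L \<union> {v} \<times> T"
      using insert.hyps(2) assms(7) by auto
    ultimately show ?case
      using insert by (simp add: remove_vertex_graph_on converse_rtranclp_into_rtranclp)
  qed
qed

lemma homotopy_steps_remove_product:
  assumes "pair_graph G" and "v \<in> pverts G" and "contractible_graph (unit_sphere G v)"
    and "pair_graph H"
  shows "homotopy_step\<^sup>*\<^sup>* (strong_product G H) (strong_product (remove_vertex G v) H)"
proof -
  let ?E = "parcs G" and ?X = "pverts G - {v}" and ?R = "strong_rel (parcs G) (parcs H)"
  have G: "finite (pverts G)" "?E \<subseteq> pverts G \<times> pverts G" "sym ?E" "irrefl ?E"
    using assms(1) by (auto simp: pair_graph_iff)
  have H: "finite (pverts H)" "sym (parcs H)" "irrefl (parcs H)"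
    using assms(4) by (auto simp: pair_graph_iff)
  have "?X \<inter> ?E `` {v} = pverts (unit_sphere G v)"
    using G by (auto simp: unit_sphere_def pair_induce_def irrefl_def)
  moreover have "contractible_on ?E (pverts (unit_sphere G v))"
    by (rule contractible_on_cong[of "parcs (unit_sphere G v)"])
      (use contractible_graphD[OF assms(3)] in
        \<open>auto simp: unit_sphere_def pair_induce_def\<close>)
  ultimately have "contractible_on ?E (?X \<inter> ?E `` {v})"
    by simp
  then have "homotopy_step\<^sup>*\<^sup>* (graph_on ?R (?X \<times> pverts H \<union> {v} \<times> pverts H))
      (graph_on ?R (?X \<times> pverts H))"
    using G H by (intro homotopy_steps_partial_product) auto
  moreover have "?X \<times> pverts H \<union> {v} \<times> pverts H = pverts G \<times> pverts H"
    using assms(2) by auto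
  moreover have "graph_on ?R (?X \<times> pverts H) = strong_product (remove_vertex G v) H"
    unfolding strong_product_eq remove_vertex_def pair_induce_def
    by (rule pair_pre_digraph.equality) (simp_all, auto simp: strong_rel_def)
  ultimately show ?thesis
    by (simp add: strong_product_eq)
qed

lemma homotopy_step_product:
  assumes "homotopy_step G K" and "pair_graph H"
  shows "homotopy_step\<^sup>*\<^sup>* (strong_product G H) (strong_product K H)"
  using assms(1)
proof cases
  case (remove v)
  then show ?thesis
    using assms(2) by (simp add: homotopy_steps_remove_product)
next
  case (add v C)
  note eqs = add_vertex_eqs[OF add(2-4)]
  have "homotopy_step\<^sup>*\<^sup>* (strong_product K H) (strong_product (remove_vertex K v) H)"
    using eqs add assms(2) by (intro homotopy_steps_remove_product) (auto simp: add_vertex_def)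
  then show ?thesis
    using eqs add(1) by (simp add: homotopy_steps_sym)
qed

lemma homotopy_steps_product:
  assumes "homotopy_step\<^sup>*\<^sup>* G K" and "pair_graph H"
  shows "homotopy_step\<^sup>*\<^sup>* (strong_product G H) (strong_product K H)"
  using assms(1) by (induction rule: rtranclp_induct)
    (auto intro: rtranclp_trans homotopy_step_product[OF _ assms(2)])

section \<open>Isomorphic copies\<close>

text \<open>
  An isomorphism out of a simple graph is determined by its vertex map, so that the isomorphic copies of
  a graph are its images under injections (\<open>digraph_iso_iff_map_graph\<close>).
\<close>

definition map_graph :: "('a \<Rightarrow> 'b) \<Rightarrow> 'a pair_pre_digraph \<Rightarrow> 'b pair_pre_digraph" where
  "map_graph f G = \<lparr> pverts = f ` pverts G, parcs = map_prod f f ` parcs G \<rparr>"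

lemma digraph_iso_iff_map_graph:
  assumes "pair_graph G"
  shows "digraph_iso (with_proj G) (with_proj H) \<longleftrightarrow> (\<exists>f. inj_on f (pverts G) \<and> H = map_graph f G)"
proof
  assume "digraph_iso (with_proj G) (with_proj H)"
  then obtain h where h: "pre_digraph.digraph_isomorphism (with_proj G) h"
    and H: "with_proj H = app_iso h (with_proj G)"
    by (auto simp: digraph_iso_def)
  have proj: "iso_tail h = fst" "iso_head h = snd" "pverts H = iso_verts h ` pverts G"
    "parcs H = iso_arcs h ` parcs G"
    using H by (auto simp: with_proj_def app_iso_def)
  have "iso_arcs h e = map_prod (iso_verts h) (iso_verts h) e" if "e \<in> parcs G" for e
    using h that proj by (auto simp: pre_digraph.digraph_isomorphism_def prod_eq_iff)
  then have "H = map_graph (iso_verts h) G"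
    using proj by (auto simp: map_graph_def intro!: pair_pre_digraph.equality)
  moreover have "inj_on (iso_verts h) (pverts G)"
    using h by (simp add: pre_digraph.digraph_isomorphism_def)
  ultimately show "\<exists>f. inj_on f (pverts G) \<and> H = map_graph f G" by blast
next
  assume "\<exists>f. inj_on f (pverts G) \<and> H = map_graph f G"
  then obtain f where f: "inj_on f (pverts G)" "H = map_graph f G" by blast
  let ?h = "\<lparr> iso_verts = f, iso_arcs = map_prod f f, iso_head = snd, iso_tail = fst \<rparr>"
  have sub: "parcs G \<subseteq> pverts G \<times> pverts G"
    using assms by (simp add: pair_graph_iff)
  have "inj_on (map_prod f f) (parcs G)"
    using map_prod_inj_on[OF f(1) f(1)] sub by (rule inj_on_subset)
  then have "pre_digraph.digraph_isomorphism (with_proj G) ?h"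
    using f(1) sub by (auto simp: pre_digraph.digraph_isomorphism_def wf_digraph_def)
  moreover have "with_proj H = app_iso ?h (with_proj G)"
    by (simp add: with_proj_def app_iso_def f(2) map_graph_def)
  ultimately show "digraph_iso (with_proj G) (with_proj H)"
    by (auto simp: digraph_iso_def)
qed

lemma parcs_map_graph:
  assumes "pair_graph G" and "inj_on f (pverts G)" and "x \<in> pverts G" and "y \<in> pverts G"
  shows "(f x, f y) \<in> parcs (map_graph f G) \<longleftrightarrow> (x, y) \<in> parcs G"
proof
  assume "(f x, f y) \<in> parcs (map_graph f G)"
  then obtain a b where ab: "(a, b) \<in> parcs G" "f a = f x" "f b = f y"
    by (auto simp: map_graph_def)
  then have "a \<in> pverts G" "b \<in> pverts G"
    using assms(1) by (auto simp: pair_graph_iff)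
  then show "(x, y) \<in> parcs G"
    using ab assms(2-4) by (auto dest: inj_onD)
qed (auto simp: map_graph_def)

lemma pair_graph_map_graph:
  assumes "pair_graph G" and "inj_on f (pverts G)"
  shows "pair_graph (map_graph f G)"
proof -
  have G: "finite (pverts G)" "parcs G \<subseteq> pverts G \<times> pverts G" "sym (parcs G)" "irrefl (parcs G)"
    using assms(1) by (auto simp: pair_graph_iff)
  have "sym (parcs (map_graph f G))"
    using G(3) by (force simp: map_graph_def sym_def)
  moreover have "irrefl (parcs (map_graph f G))"
    using G(2,4) assms(2) by (auto simp: map_graph_def irrefl_def dest: inj_onD)
  ultimately show ?thesis
    using G(1,2) by (auto simp: pair_graph_iff map_graph_def)
qed

lemma map_graph_pair_induce:
  assumes "pair_graph G" and "inj_on f (pverts G)" and "S \<subseteq> pverts G"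
  shows "map_graph f (pair_induce G S) = pair_induce (map_graph f G) (f ` S)"
proof (rule pair_pre_digraph.equality)
  have "parcs G \<subseteq> pverts G \<times> pverts G"
    using assms(1) by (simp add: pair_graph_iff)
  then show "parcs (map_graph f (pair_induce G S)) = parcs (pair_induce (map_graph f G) (f ` S))"
    using assms(2,3) by (fastforce simp: map_graph_def pair_induce_def dest: inj_onD)
qed (auto simp: map_graph_def pair_induce_def)

lemma remove_vertex_map_graph:
  assumes "pair_graph G" and "inj_on f (pverts G)" and "v \<in> pverts G"
  shows "remove_vertex (map_graph f G) (f v) = map_graph f (remove_vertex G v)"
proof -
  have "pverts (map_graph f G) - {f v} = f ` (pverts G - {v})"
    using assms by (auto simp: map_graph_def inj_on_def)
  then show ?thesis
    unfolding remove_vertex_def using assms by (simp add: map_graph_pair_induce)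
qed

lemma unit_sphere_map_graph:
  assumes "pair_graph G" and "inj_on f (pverts G)" and "v \<in> pverts G"
  shows "unit_sphere (map_graph f G) (f v) = map_graph f (unit_sphere G v)"
proof -
  have sub: "parcs G \<subseteq> pverts G \<times> pverts G"
    using assms(1) by (simp add: pair_graph_iff)
  then have "{y. (f v, y) \<in> parcs (map_graph f G)} = f ` {y. (v, y) \<in> parcs G}"
    using assms by (fastforce simp: map_graph_def dest: inj_onD)
  then show ?thesis
    unfolding unit_sphere_def using assms sub by (subst map_graph_pair_induce) auto
qed

lemma contractible_graph_map_graph:
  assumes "contractible_graph G" and "inj_on f (pverts G)"
  shows "contractible_graph (map_graph f G)"
proof -
  have G: "pair_graph G" "contractible_on (parcs G) (pverts G)"
    using contractible_graphD[OF assms(1)] by auto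
  have fG: "pair_graph (map_graph f G)"
    using G(1) assms(2) by (rule pair_graph_map_graph)
  have "contractible_on (parcs (map_graph f G)) (f ` pverts G)"
    using contractible_on_image[OF G(2) assms(2)] parcs_map_graph[OF G(1) assms(2)] by blast
  then have "contractible_graph (graph_on (parcs (map_graph f G)) (pverts (map_graph f G)))"
    using fG by (intro contractible_graph_on) (auto simp: pair_graph_iff map_graph_def)
  then show ?thesis
    using graph_on_parcs[OF fG] by simp
qed

lemma homotopy_step_remove_map_graph:
  assumes "pair_graph G" and "v \<in> pverts G" and "contractible_graph (unit_sphere G v)"
    and "inj_on f (pverts G)"
  shows "homotopy_step (map_graph f G) (map_graph f (remove_vertex G v))"
proof -
  have "pverts (unit_sphere G v) \<subseteq> pverts G"
    using assms(1) by (auto simp: unit_sphere_def pair_induce_def pair_graph_iff)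
  then have "contractible_graph (unit_sphere (map_graph f G) (f v))"
    using assms contractible_graph_map_graph[OF assms(3) inj_on_subset[OF assms(4)]]
    by (simp add: unit_sphere_map_graph)
  then have "homotopy_step (map_graph f G) (remove_vertex (map_graph f G) (f v))"
    using assms by (intro homotopy_step.remove pair_graph_map_graph) (auto simp: map_graph_def)
  then show ?thesis
    using assms by (simp add: remove_vertex_map_graph)
qed

text \<open>
  A removal is transported by the given isomorphism. For an added vertex \<open>v\<close>, the isomorphism is extended by
  sending \<open>v\<close> to a fresh number, which exists because the copy is finite; the step is then the reverse
  of a transported removal.
\<close>

lemma homotopy_step_transport:
  fixes G' :: "nat pair_pre_digraph"
  assumes "homotopy_step G K" and "digraph_iso (with_proj G) (with_proj G')"
  shows "\<exists>K'. homotopy_step G' K' \<and> digraph_iso (with_proj K) (with_proj K')"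
proof -
  have gr: "pair_graph G" "pair_graph K"
    using homotopy_step_pair_graph[OF assms(1)] by auto
  obtain f where f: "inj_on f (pverts G)" "G' = map_graph f G"
    using assms(2) gr by (auto simp: digraph_iso_iff_map_graph)
  show ?thesis
    using assms(1)
  proof cases
    case (remove v)
    then have "homotopy_step G' (map_graph f K)"
      using f by (simp add: homotopy_step_remove_map_graph)
    moreover have "inj_on f (pverts K)"
      using f remove by (auto simp: remove_vertex_def pair_induce_def inj_on_def)
    ultimately show ?thesis
      using gr by (auto simp: digraph_iso_iff_map_graph)
  next
    case (add v C)
    note eqs = add_vertex_eqs[OF add(2-4)]
    have "finite (f ` pverts G)"
      using gr by (simp add: pair_graph_iff)
    then obtain w where w: "w \<notin> f ` pverts G"
      using ex_new_if_finite infinite_UNIV_nat by blast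
    let ?g = "f(v := w)"
    have K: "pverts K = insert v (pverts G)"
      using add by (simp add: add_vertex_def)
    have inj: "inj_on ?g (pverts K)"
      using f(1) w add(3) unfolding K by (auto simp: inj_on_def)
    \<comment> \<open>The fresh value only concerns \<open>v\<close>, so the copy of the old part is still \<open>G'\<close>.\<close>
    have "map_graph ?g G = map_graph f G"
    proof -
      have "parcs G \<subseteq> pverts G \<times> pverts G"
        using gr by (simp add: pair_graph_iff)
      then have "map_prod ?g ?g ` parcs G = map_prod f f ` parcs G"
        using add(3) by (intro image_cong) auto
      moreover have "?g ` pverts G = f ` pverts G"
        using add(3) by (intro image_cong) auto
      ultimately show ?thesis by (simp add: map_graph_def)
    qed
    moreover have "homotopy_step (map_graph ?g K) (map_graph ?g (remove_vertex K v))"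
      using inj gr eqs add K by (intro homotopy_step_remove_map_graph) auto
    ultimately have "homotopy_step G' (map_graph ?g K)"
      using eqs add(1) f(2) by (simp add: homotopy_step_sym)
    then show ?thesis
      using inj gr digraph_iso_iff_map_graph by blast
  qed
qed

lemma homotopy_steps_transport:
  fixes G' :: "nat pair_pre_digraph"
  assumes "homotopy_step\<^sup>*\<^sup>* G K" and "digraph_iso (with_proj G) (with_proj G')"
  shows "\<exists>K'. homotopy_step\<^sup>*\<^sup>* G' K' \<and> digraph_iso (with_proj K) (with_proj K')"
  using assms
proof (induction rule: rtranclp_induct)
  case base
  then show ?case by blast
next
  case (step H K)
  then show ?case
    by (meson homotopy_step_transport rtranclp.rtrancl_into_rtrancl)
qed

lemma pair_graph_digraph_iso:
  "pair_graph G \<Longrightarrow> digraph_iso (with_proj G) (with_proj H) \<Longrightarrow> pair_graph H"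
  by (auto simp: digraph_iso_iff_map_graph intro: pair_graph_map_graph)

lemma digraph_iso_pair_sym:
  "pair_graph G \<Longrightarrow> digraph_iso (with_proj G) (with_proj H) \<Longrightarrow> digraph_iso (with_proj H) (with_proj G)"
  by (auto intro!: digraph_iso_swap simp: wf_digraph_def pair_graph_iff)

lemma digraph_iso_strong_product:
  assumes "pair_graph G" and "pair_graph H" and "digraph_iso (with_proj G) (with_proj G')"
  shows "digraph_iso (with_proj (strong_product G H)) (with_proj (strong_product G' H))"
proof -
  obtain f where f: "inj_on f (pverts G)" "G' = map_graph f G"
    using assms by (auto simp: digraph_iso_iff_map_graph)
  have sub: "parcs G \<subseteq> pverts G \<times> pverts G"
    using assms by (simp add: pair_graph_iff)
  have "strong_product G' H = map_graph (map_prod f id) (strong_product G H)"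
  proof (rule pair_pre_digraph.equality)
    show "pverts (strong_product G' H) = pverts (map_graph (map_prod f id) (strong_product G H))"
      by (auto simp: strong_product_def map_graph_def f(2) map_prod_def image_iff)
    show "parcs (strong_product G' H) = parcs (map_graph (map_prod f id) (strong_product G H))"
    proof (intro set_eqI iffI)
      fix e assume e_arc: "e \<in> parcs (strong_product G' H)"
      obtain x b y d where xy: "e = ((x, b), (y, d))"
        by (metis surj_pair)
      then have "x \<in> pverts G'" "y \<in> pverts G'"
        using e_arc by (auto simp: strong_product_def)
      then obtain a c where "a \<in> pverts G" "x = f a" "c \<in> pverts G" "y = f c"
        by (auto simp: f(2) map_graph_def)
      then have e: "e = ((f a, b), (f c, d))" "a \<in> pverts G" "c \<in> pverts G"
        "((f a, b), (f c, d)) \<in> parcs (strong_product G' H)"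
        using xy e_arc by simp_all
      then have "((a, b), (c, d)) \<in> parcs (strong_product G H)"
        using parcs_map_graph[OF assms(1) f(1) e(2,3)] f
        by (auto simp: strong_product_def dest: inj_onD)
      then show "e \<in> parcs (map_graph (map_prod f id) (strong_product G H))"
        unfolding e(1) by (force simp: map_graph_def)
    next
      fix e assume "e \<in> parcs (map_graph (map_prod f id) (strong_product G H))"
      then obtain a b c d where e: "e = ((f a, b), (f c, d))"
        "((a, b), (c, d)) \<in> parcs (strong_product G H)"
        by (auto simp: map_graph_def)
      then have "a \<in> pverts G" "c \<in> pverts G"
        by (auto simp: strong_product_def)
      then show "e \<in> parcs (strong_product G' H)"
        using e parcs_map_graph[OF assms(1) f(1), of a c] f
        by (auto simp: strong_product_def map_graph_def dest: inj_onD)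
    qed
  qed simp
  moreover have "inj_on (map_prod f id) (pverts (strong_product G H))"
    using f(1) by (auto simp: strong_product_def inj_on_def)
  ultimately show ?thesis
    using assms pair_graph_strong_product digraph_iso_iff_map_graph by blast
qed

lemma digraph_iso_strong_product_swap:
  assumes "pair_graph G" and "pair_graph H"
  shows "digraph_iso (with_proj (strong_product G H)) (with_proj (strong_product H G))"
proof -
  have "strong_product H G = map_graph prod.swap (strong_product G H)"
    by (rule pair_pre_digraph.equality)
      (force simp: strong_product_def map_graph_def)+
  then show ?thesis
    using assms pair_graph_strong_product digraph_iso_iff_map_graph inj_on_subset[OF inj_swap]
    by blast
qed

section \<open>Homotopy\<close>

text \<open>
  Homotopies may be carried out in any vertex type, in particular among products: the whole chain of
  steps is transported to copies with natural numbers as vertices.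
\<close>

lemma homotopic_graphsI:
  assumes "pair_graph G" and "homotopy_step\<^sup>*\<^sup>* G K" and "digraph_iso (with_proj K) (with_proj H)"
  shows "homotopic_graphs G H"
proof -
  obtain f :: "_ \<Rightarrow> nat" where "inj_on f (pverts G)"
    using assms(1) finite_imp_inj_to_nat_seg by (metis pair_graph_iff)
  then have G: "digraph_iso (with_proj G) (with_proj (map_graph f G))"
    using assms(1) by (auto simp: digraph_iso_iff_map_graph)
  obtain K' where K': "homotopy_step\<^sup>*\<^sup>* (map_graph f G) K'" "digraph_iso (with_proj K) (with_proj K')"
    using homotopy_steps_transport[OF assms(2) G] by blast
  have "digraph_iso (with_proj K') (with_proj K)"
    using digraph_iso_pair_sym K'(2) homotopy_steps_pair_graph[OF assms(2,1)] by blast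
  then show ?thesis
    unfolding homotopic_graphs_def using G K'(1) assms(3) digraph_iso_trans by blast
qed

lemma homotopic_graphs_iso:
  "pair_graph G \<Longrightarrow> digraph_iso (with_proj G) (with_proj H) \<Longrightarrow> homotopic_graphs G H"
  by (rule homotopic_graphsI[OF _ rtranclp.rtrancl_refl])

text \<open>
  The two homotopies meet in different copies of \<^term>\<open>H\<close>. Transporting the second one to the copy where the
  first one ends makes them composable.
\<close>

lemma homotopic_graphs_trans:
  assumes "homotopic_graphs G H" and "homotopic_graphs H K" and "pair_graph G"
  shows "homotopic_graphs G K"
proof -
  obtain G1 H1 :: "nat pair_pre_digraph" where 1: "digraph_iso (with_proj G) (with_proj G1)"
    "homotopy_step\<^sup>*\<^sup>* G1 H1" "digraph_iso (with_proj H1) (with_proj H)"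
    using assms(1) by (auto simp: homotopic_graphs_def)
  obtain H2 K2 :: "nat pair_pre_digraph" where 2: "digraph_iso (with_proj H) (with_proj H2)"
    "homotopy_step\<^sup>*\<^sup>* H2 K2" "digraph_iso (with_proj K2) (with_proj K)"
    using assms(2) by (auto simp: homotopic_graphs_def)
  have H1: "pair_graph H1"
    using homotopy_steps_pair_graph 1(2) pair_graph_digraph_iso[OF assms(3) 1(1)] by blast
  have iso: "digraph_iso (with_proj H1) (with_proj H2)"
    using 1(3) 2(1) by (rule digraph_iso_trans)
  have H2: "pair_graph H2" "digraph_iso (with_proj H2) (with_proj H1)"
    using pair_graph_digraph_iso[OF H1 iso] digraph_iso_pair_sym[OF H1 iso] by auto
  obtain K1 where K1: "homotopy_step\<^sup>*\<^sup>* H1 K1" "digraph_iso (with_proj K2) (with_proj K1)"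
    using homotopy_steps_transport[OF 2(2) H2(2)] by blast
  have "digraph_iso (with_proj K1) (with_proj K2)"
    using digraph_iso_pair_sym K1(2) homotopy_steps_pair_graph[OF 2(2) H2(1)] by blast
  then have "digraph_iso (with_proj K1) (with_proj K)"
    using 2(3) by (rule digraph_iso_trans)
  then show ?thesis
    unfolding homotopic_graphs_def using 1(1,2) K1(1) rtranclp_trans by metis
qed

lemma homotopic_graphs_strong_product:
  assumes "pair_graph G" and "pair_graph H" and "homotopic_graphs G G'"
  shows "homotopic_graphs (strong_product G H) (strong_product G' H)"
proof -
  obtain K K' :: "nat pair_pre_digraph" where K: "digraph_iso (with_proj G) (with_proj K)"
    "homotopy_step\<^sup>*\<^sup>* K K'" "digraph_iso (with_proj K') (with_proj G')"
    using assms(3) by (auto simp: homotopic_graphs_def)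
  have gr: "pair_graph K" "pair_graph K'"
    using pair_graph_digraph_iso[OF assms(1) K(1)] homotopy_steps_pair_graph[OF K(2)] by auto
  have "homotopic_graphs (strong_product G H) (strong_product K H)"
    using assms K(1)
    by (intro homotopic_graphs_iso pair_graph_strong_product digraph_iso_strong_product)
  moreover have "homotopic_graphs (strong_product K H) (strong_product G' H)"
    using gr assms K
    by (intro homotopic_graphsI[of _ "strong_product K' H"] pair_graph_strong_product
        homotopy_steps_product digraph_iso_strong_product)
  ultimately show ?thesis
    using homotopic_graphs_trans assms(1,2) pair_graph_strong_product by blast
qed

theorem theorem4:
  fixes A :: "'a pair_pre_digraph" and A' :: "'b pair_pre_digraph"
    and B :: "'c pair_pre_digraph" and B' :: "'d pair_pre_digraph"
  assumes "pair_graph A" and "pair_graph A'" and "pair_graph B" and "pair_graph B'"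
    and "homotopic_graphs A A'" and "homotopic_graphs B B'"
  shows "homotopic_graphs (strong_product A B) (strong_product A' B')"
proof -
  note gr = assms(1-4) pair_graph_strong_product
  have "homotopic_graphs (strong_product A B) (strong_product A' B)"
    using assms by (intro homotopic_graphs_strong_product)
  moreover have "homotopic_graphs (strong_product A' B) (strong_product B A')"
    using gr by (intro homotopic_graphs_iso digraph_iso_strong_product_swap)
  moreover have "homotopic_graphs (strong_product B A') (strong_product B' A')"
    using assms by (intro homotopic_graphs_strong_product)
  moreover have "homotopic_graphs (strong_product B' A') (strong_product A' B')"
    using gr by (intro homotopic_graphs_iso digraph_iso_strong_product_swap)
  ultimately show ?thesis
    using gr by (meson homotopic_graphs_trans)
qed

end
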